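(* Let $(X,d_X)$ and $(Y,d_Y)$ be metric spaces, let $f:X\to Y$ be a mapping, and let $y\in Y$. If $f$ is strongly co-Lipschitz at each element of $f^{-1}(y)$, then $f^{-1}(y)$ is a discrete set. In particular, if $f$ is strongly co-Lipschitz at every $x\in X$, then $f$ is a discrete mapping.
   Context: $B^Z_s(z)$ denotes the open ball of radius $s>0$ centred at $z$ in the metric space $Z$; $\mathrm{Int}$ denotes topological interior. For $c>0$, $f$ is strongly $c$-co-Lipschitz at $x_0\in X$ if there is $\rho>0$ such that (i) $f(x_0)\in\mathrm{Int}\left(f(B^X_\rho(x_0))\right)$ and (ii) $d_Y(f(x),f(x_0))\ge c\,d_X(x,x_0)$ for all $x\in B^X_\rho(x_0)$; $f$ is strongly co-Lipschitz at $x_0$ if it is strongly $c$-co-Lipschitz at $x_0$ for some $c>0$ (which may depend on $x_0$). A subset $S\subseteq X$ is a discrete set if for each $x\in S$ there is a neighbourhood $U$ of $x$ with $U\cap S=\{x\}$; $f$ is a discrete mapping if $f^{-1}(y)$ is a discrete set for each $y\in Y$. *)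

theory Defs
  imports "HOL-Analysis.Analysis"
begin

text \<open>Only meaningful for \<open>c > 0\<close>; positivity is required where \<open>c\<close> is quantified below.\<close>

definition strongly_co_lipschitz_const_at ::
    "real \<Rightarrow> ('a::metric_space \<Rightarrow> 'b::metric_space) \<Rightarrow> 'a \<Rightarrow> bool"
  where "strongly_co_lipschitz_const_at c f x0 \<longleftrightarrow>
    (\<exists>\<rho>>0. f x0 \<in> interior (f ` ball x0 \<rho>) \<and>
           (\<forall>x\<in>ball x0 \<rho>. dist (f x) (f x0) \<ge> c * dist x x0))"

definition strongly_co_lipschitz_at ::
    "('a::metric_space \<Rightarrow> 'b::metric_space) \<Rightarrow> 'a \<Rightarrow> bool"
  where "strongly_co_lipschitz_at f x0 \<longleftrightarrow> (\<exists>c>0. strongly_co_lipschitz_const_at c f x0)"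

definition discrete_mapping :: "('a::topological_space \<Rightarrow> 'b) \<Rightarrow> bool"
  where "discrete_mapping f \<longleftrightarrow> (\<forall>y. discrete (f -` {y}))"

end

theory Submission
  imports Defs
begin

text \<open>
  The growth bound makes fibres discrete: if \<open>f x = f x0\<close> for a point \<open>x\<close> of the ball on
  which the bound holds, then \<open>c * dist x x0 \<le> dist (f x) (f x0) = 0\<close>, so \<open>x = x0\<close>. Thus \<open>x0\<close>
  is the only point of its own fibre in that ball.
\<close>

lemma strongly_co_lipschitz_at_imp_isolated_in_fibre:
  assumes "strongly_co_lipschitz_at f x0"
  shows "x0 isolated_in (f -` {f x0})"
proof -
  obtain c \<rho> where "c > 0" "\<rho> > 0"
    and growth: "\<And>x. x \<in> ball x0 \<rho> \<Longrightarrow> c * dist x x0 \<le> dist (f x) (f x0)"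
    using assms
    unfolding strongly_co_lipschitz_at_def strongly_co_lipschitz_const_at_def by blast
  have "x = x0" if "x \<in> ball x0 \<rho>" "f x = f x0" for x
    using growth[OF that(1)] that(2) \<open>c > 0\<close> by (simp add: mult_le_0_iff)
  then have "ball x0 \<rho> \<inter> f -` {f x0} = {x0}"
    using \<open>\<rho> > 0\<close> by auto
  then show ?thesis
    unfolding isolated_in_def using open_ball by blast
qed

theorem lemma2p29:
  fixes f :: "'a::metric_space \<Rightarrow> 'b::metric_space" and y :: 'b
  shows "((\<forall>x\<in>f -` {y}. strongly_co_lipschitz_at f x) \<longrightarrow> discrete (f -` {y})) \<and>
         ((\<forall>x. strongly_co_lipschitz_at f x) \<longrightarrow> discrete_mapping f)"
proof -
  have "discrete (f -` {z})" if "\<forall>x\<in>f -` {z}. strongly_co_lipschitz_at f x" for z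
    unfolding discrete_def
    using that strongly_co_lipschitz_at_imp_isolated_in_fibre[of f] by fastforce
  then show ?thesis
    unfolding discrete_mapping_def by blast
qed

end
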